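(* Let $n\ge 4$ be even, let $x^1,\dots,x^n\in\mathbb{R}^m$, let $d_{ij}=\|x^i-x^j\|_2^2$, and let $\mathcal{C}_1=\{1,\dots,n/2\}$, $\mathcal{C}_2=\{n/2+1,\dots,n\}$ be the planted clusters. For $i\in\mathcal{C}_l$, $l\in\{1,2\}$, put $$d_i^{\mathrm{in}}:=\frac{1}{|\mathcal{C}_l|}\sum_{j\in\mathcal{C}_l} d_{ij},$$ and define $$\eta:=\frac12\Big(\frac{1}{|\mathcal{C}_1|}\sum_{i\in\mathcal{C}_1} d_i^{\mathrm{in}}+\frac{1}{|\mathcal{C}_2|}\sum_{i\in\mathcal{C}_2} d_i^{\mathrm{in}}\Big).$$ If for all $l\in\{1,2\}$ and all $i,j\in\mathcal{C}_l$ we have $$\frac{1}{|[n]\setminus\mathcal{C}_l|}\sum_{k\in[n]\setminus\mathcal{C}_l}\min\{d_{ik}+d_j^{\mathrm{in}},\ d_{jk}+d_i^{\mathrm{in}}\}-d_{ij}\ \ge\ \eta,$$ then the ratio-cut vector $\bar X$ corresponding to the planted clusters is an optimal solution of the linear program (LP2) given in the context.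
   Context: Notation: $[n]=\{1,\dots,n\}$. (LP2) is the following linear program in the entries of a symmetric matrix $X\in\mathbb{R}^{n\times n}$ ($X_{ij}=X_{ji}$): $$\min \sum_{i,j\in[n]} d_{ij}X_{ij}\quad\text{s.t.}\quad \operatorname{Tr}(X)=2,\quad \sum_{j=1}^n X_{ij}=1\ \ \forall i\in[n],\quad X_{ij}+X_{ik}\le X_{ii}+X_{jk}\ \ \forall \text{ distinct } i,j,k\in[n].$$ The ratio-cut vector of the planted clusters is given by $\bar X_{ij}=2/n$ if $i\neq j$ belong to the same cluster $\mathcal{C}_l$, and $\bar X_{ij}=0$ if $i,j$ belong to different clusters; as a point of (LP2) its diagonal entries are $\bar X_{ii}=1-\sum_{j\ne i}\bar X_{ij}=2/n$. *)

theory Defs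
  imports "HOL-Analysis.Analysis"
begin

text \<open>
  Points and matrices are indexed by \<open>[n] = {1..n}\<close>: an \<open>n \<times> n\<close> matrix is a function
  \<open>nat \<Rightarrow> nat \<Rightarrow> real\<close> of which only the entries with indices in \<open>{1..n}\<close> are ever used.
\<close>

definition sqdist :: "(nat \<Rightarrow> real ^ 'm) \<Rightarrow> nat \<Rightarrow> nat \<Rightarrow> real" where
  "sqdist x i j = (norm (x i - x j))\<^sup>2"

definition planted_cluster :: "nat \<Rightarrow> nat \<Rightarrow> nat set" where
  "planted_cluster n l = (if l = 1 then {1..n div 2} else if l = 2 then {n div 2 + 1..n} else {})"

definition avg_in :: "(nat \<Rightarrow> nat \<Rightarrow> real) \<Rightarrow> nat set \<Rightarrow> nat \<Rightarrow> real" where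
  "avg_in d C i = 1 / real (card C) * (\<Sum>j\<in>C. d i j)"

definition planted_eta :: "(nat \<Rightarrow> nat \<Rightarrow> real) \<Rightarrow> nat \<Rightarrow> real" where
  "planted_eta d n =
     1 / 2 * (1 / real (card (planted_cluster n 1)) *
                (\<Sum>i\<in>planted_cluster n 1. avg_in d (planted_cluster n 1) i)
            + 1 / real (card (planted_cluster n 2)) *
                (\<Sum>i\<in>planted_cluster n 2. avg_in d (planted_cluster n 2) i))"

definition lp2_feasible :: "nat \<Rightarrow> (nat \<Rightarrow> nat \<Rightarrow> real) \<Rightarrow> bool" where
  "lp2_feasible n X \<longleftrightarrow>
     (\<forall>i\<in>{1..n}. \<forall>j\<in>{1..n}. X i j = X j i) \<and>
     (\<Sum>i\<in>{1..n}. X i i) = 2 \<and>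
     (\<forall>i\<in>{1..n}. (\<Sum>j\<in>{1..n}. X i j) = 1) \<and>
     (\<forall>i\<in>{1..n}. \<forall>j\<in>{1..n}. \<forall>k\<in>{1..n}. i \<noteq> j \<longrightarrow> i \<noteq> k \<longrightarrow> j \<noteq> k \<longrightarrow>
        X i j + X i k \<le> X i i + X j k)"

definition lp2_objective :: "nat \<Rightarrow> (nat \<Rightarrow> nat \<Rightarrow> real) \<Rightarrow> (nat \<Rightarrow> nat \<Rightarrow> real) \<Rightarrow> real" where
  "lp2_objective n d X = (\<Sum>i\<in>{1..n}. \<Sum>j\<in>{1..n}. d i j * X i j)"

definition lp2_optimal :: "nat \<Rightarrow> (nat \<Rightarrow> nat \<Rightarrow> real) \<Rightarrow> (nat \<Rightarrow> nat \<Rightarrow> real) \<Rightarrow> bool" where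
  "lp2_optimal n d X \<longleftrightarrow>
     lp2_feasible n X \<and> (\<forall>Y. lp2_feasible n Y \<longrightarrow> lp2_objective n d X \<le> lp2_objective n d Y)"

text \<open>
  The ratio-cut vector has one coordinate per pair \<open>i \<noteq> j\<close>; it becomes a matrix by letting
  the diagonal be determined by the row-sum constraint.
\<close>

definition ratio_cut_vector :: "nat \<Rightarrow> nat \<Rightarrow> nat \<Rightarrow> real" where
  "ratio_cut_vector n i j =
     (if \<exists>l\<in>{1, 2}. i \<in> planted_cluster n l \<and> j \<in> planted_cluster n l then 2 / real n else 0)"

definition ratio_cut_matrix :: "nat \<Rightarrow> nat \<Rightarrow> nat \<Rightarrow> real" where
  "ratio_cut_matrix n i j =
     (if i = j then 1 - (\<Sum>k\<in>{1..n} - {i}. ratio_cut_vector n i k) else ratio_cut_vector n i j)"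

lemma ratio_cut_matrix_diag:
  assumes "even n" and i: "i \<in> {1..n}"
  shows "ratio_cut_matrix n i i = 2 / real n"
proof -
  obtain h where h: "n = 2 * h" using assms(1) by (rule evenE)
  have "\<exists>C. i \<in> C \<and> card C = h \<and> C \<subseteq> {1..n} \<and>
          (\<forall>k\<in>{1..n}. ratio_cut_vector n i k = (if k \<in> C then 2 / real n else 0))"
  proof (cases "i \<le> h")
    case True
    then show ?thesis using i h
      by (intro exI[of _ "{1..h}"]) (auto simp: ratio_cut_vector_def planted_cluster_def)
  next
    case False
    then show ?thesis using i h
      by (intro exI[of _ "{h + 1..n}"]) (auto simp: ratio_cut_vector_def planted_cluster_def)
  qed
  then obtain C where C: "i \<in> C" "card C = h" "C \<subseteq> {1..n}"
    and v: "\<And>k. k \<in> {1..n} \<Longrightarrow> ratio_cut_vector n i k = (if k \<in> C then 2 / real n else 0)"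
    by blast
  have "(\<Sum>k\<in>{1..n}. ratio_cut_vector n i k) = (\<Sum>k\<in>{1..n}. if k \<in> C then 2 / real n else 0)"
    by (intro sum.cong refl v)
  also have "\<dots> = (\<Sum>k\<in>{1..n} \<inter> C. 2 / real n)"
    by (rule sum.inter_restrict [symmetric]) simp
  also have "{1..n} \<inter> C = C" using C by blast
  also have "(\<Sum>k\<in>C. 2 / real n) = 1" using C i h by simp
  finally have "(\<Sum>k\<in>{1..n} - {i}. ratio_cut_vector n i k) = 1 - ratio_cut_vector n i i"
    using i by (simp add: sum_diff1)
  then show ?thesis using v[OF i] C by (simp add: ratio_cut_matrix_def)
qed

end

theory Submission
  imports Defs
begin

text \<open>
  The proof is linear programming duality with an explicit dual solution. Let \<open>A\<close>, \<open>B\<close> be the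
  two clusters, both of size \<open>h = n/2\<close>. Complementary slackness with the ratio-cut matrix only
  allows positive multipliers on triangle inequalities \<open>X i j + X i k \<le> X i i + X j k\<close> in which
  \<open>i\<close> shares its cluster with \<open>j\<close> or \<open>k\<close>. For \<open>i, j\<close> in one cluster and \<open>k\<close> in the other one, the
  multiplier is chosen as \<open>1/h\<close> times the nonnegative number
  \<open>d j k + d_in i - min (d i k + d_in j) (d j k + d_in i)\<close>.
  The factor \<open>1/h\<close> is what makes the coefficients of the entries \<open>X i k\<close> between the clusters come
  out as \<open>d i k\<close>, up to row-sum multipliers. What is then still missing on an entry \<open>X i j\<close> inside a
  cluster is, up to sign, the excess of the left-hand side of the recovery condition over \<open>\<eta>\<close>,
  which is nonnegative by hypothesis. These excesses serve as multipliers of the inequalities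
  \<open>2 * X i j \<le> X i i + X j j\<close>, which are consequences of the triangle inequalities through a
  third index in the other cluster.

  With these weights the objective of every symmetric \<open>X\<close> with unit row sums and trace 2 equals
  \<open>n * \<eta>\<close> plus the weighted slacks (\<open>objective_eq_surplus\<close>). For a feasible \<open>X\<close> the weighted
  slacks are nonnegative (\<open>cluster_surplus_nonneg\<close>), and for the ratio-cut matrix they all vanish
  (\<open>cluster_surplus_eq_0\<close>), so its value \<open>n * \<eta>\<close> is the minimum.
\<close>

section \<open>The dual certificate\<close>

definition cross_min :: "(nat \<Rightarrow> nat \<Rightarrow> real) \<Rightarrow> nat set \<Rightarrow> nat \<Rightarrow> nat \<Rightarrow> nat \<Rightarrow> real" where
  "cross_min d A i j k = min (d i k + avg_in d A j) (d j k + avg_in d A i)"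

definition recovery_slack ::
  "(nat \<Rightarrow> nat \<Rightarrow> real) \<Rightarrow> nat set \<Rightarrow> nat set \<Rightarrow> real \<Rightarrow> nat \<Rightarrow> nat \<Rightarrow> real" where
  "recovery_slack d A B e i j =
     1 / real (card B) * (\<Sum>k\<in>B. cross_min d A i j k) - d i j - e"

text \<open>
  The contribution of the cluster \<open>A\<close> to the weighted slacks. The second sum is the weighted sum
  of the inequalities \<open>2 * X i j \<le> X i i + X j j\<close> written without symmetrization. Terms with
  \<open>i = j\<close> are included because they vanish.
\<close>

definition cluster_surplus ::
  "(nat \<Rightarrow> nat \<Rightarrow> real) \<Rightarrow> nat set \<Rightarrow> nat set \<Rightarrow> real \<Rightarrow> (nat \<Rightarrow> nat \<Rightarrow> real) \<Rightarrow> real" where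
  "cluster_surplus d A B e X =
     1 / real (card B) * (\<Sum>i\<in>A. \<Sum>j\<in>A. \<Sum>k\<in>B.
        (d j k + avg_in d A i - cross_min d A i j k) * (X i i + X j k - X i j - X i k))
     + (\<Sum>i\<in>A. \<Sum>j\<in>A. recovery_slack d A B e i j * (X i i - X i j))"

lemma cross_min_commute: "cross_min d A i j k = cross_min d A j i k"
  by (simp add: cross_min_def min.commute)

lemma recovery_slack_commute:
  assumes "\<And>i j. d i j = d j i"
  shows "recovery_slack d A B e i j = recovery_slack d A B e j i"
  using assms[of i j] by (simp add: recovery_slack_def cross_min_commute[of d A i j])

lemma sum_eq_card_avg_in:
  assumes "card C > 0"
  shows "(\<Sum>j\<in>C. d i j) = real (card C) * avg_in d C i"
  using assms by (simp add: avg_in_def)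

text \<open>
  The point of adding the two parts of the surplus is that the nonlinear terms \<open>cross_min\<close> cancel:
  against \<open>X j k - X i k\<close> because they are symmetric in \<open>i\<close> and \<open>j\<close>, and against \<open>X i i - X i j\<close>
  because they occur with the opposite sign in \<open>recovery_slack\<close>. What remains is linear in \<open>d\<close>.
\<close>

lemma cluster_surplus_linear:
  fixes d X :: "nat \<Rightarrow> nat \<Rightarrow> real"
  assumes hA: "card A = h" and hB: "card B = h" and h: "h > 0"
    and d: "\<And>i j. d i j = d j i"
    and X: "\<And>i j. i \<in> A \<union> B \<Longrightarrow> j \<in> A \<union> B \<Longrightarrow> X i j = X j i"
  shows "cluster_surplus d A B e X =
     (\<Sum>i\<in>A. \<Sum>j\<in>A. d i j * X i j) + (\<Sum>i\<in>A. \<Sum>k\<in>B. d i k * X i k)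
     - (\<Sum>k\<in>B. avg_in d A k * (\<Sum>i\<in>A. X k i))
     - (\<Sum>j\<in>A. avg_in d B j * (\<Sum>i\<in>A. X j i))
     - (\<Sum>i\<in>A. avg_in d A i * ((\<Sum>j\<in>A. X i j) + (\<Sum>k\<in>B. X i k)))
     + 1 / real h * (\<Sum>i\<in>A. avg_in d A i) * (\<Sum>i\<in>A. \<Sum>k\<in>B. X i k)
     + ((\<Sum>j\<in>A. avg_in d B j) - real h * e) * (\<Sum>i\<in>A. X i i)
     + e * (\<Sum>i\<in>A. \<Sum>j\<in>A. X i j)"
proof -
  define p where "p = avg_in d A"
  define q where "q = avg_in d B"
  define m where "m = cross_min d A"
  define H where "H = real h"
  have H: "H > 0" using h by (simp add: H_def)
  have rowA: "(\<Sum>j\<in>A. d i j) = H * p i" for i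
    using sum_eq_card_avg_in[of A d i] hA h by (simp add: p_def H_def)
  have rowB: "(\<Sum>j\<in>B. d i j) = H * q i" for i
    using sum_eq_card_avg_in[of B d i] hB h by (simp add: q_def H_def)
  have cA: "real (card A) = H" and cB: "real (card B) = H" using hA hB by (auto simp: H_def)
  \<comment> \<open>exchange of \<open>i\<close> and \<open>j\<close>\<close>
  have m_cancel: "(\<Sum>i\<in>A. \<Sum>j\<in>A. \<Sum>k\<in>B. m i j k * X j k) = (\<Sum>i\<in>A. \<Sum>j\<in>A. \<Sum>k\<in>B. m i j k * X i k)"
    by (subst sum.swap) (simp add: m_def cross_min_commute)
  have t1: "(\<Sum>i\<in>A. \<Sum>j\<in>A. \<Sum>k\<in>B. d j k * X j k) = H * (\<Sum>i\<in>A. \<Sum>k\<in>B. d i k * X i k)"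
    by (simp add: cA)
  have t2: "(\<Sum>i\<in>A. \<Sum>j\<in>A. \<Sum>k\<in>B. d j k * X i k) = H * (\<Sum>k\<in>B. p k * (\<Sum>i\<in>A. X k i))"
  proof -
    have transpose: "d j k * X i k = d k j * X k i" if "i \<in> A" "k \<in> B" for i j k
      using d[of j k] X[of i k] that by (metis UnCI)
    have "(\<Sum>i\<in>A. \<Sum>j\<in>A. \<Sum>k\<in>B. d j k * X i k) = (\<Sum>i\<in>A. \<Sum>j\<in>A. \<Sum>k\<in>B. d k j * X k i)"
      by (intro sum.cong refl transpose)
    also have "\<dots> = (\<Sum>i\<in>A. \<Sum>k\<in>B. (\<Sum>j\<in>A. d k j) * X k i)"
      unfolding sum_distrib_right by (rule sum.cong[OF refl], rule sum.swap)
    also have "\<dots> = (\<Sum>k\<in>B. \<Sum>i\<in>A. (H * p k) * X k i)"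
      by (subst sum.swap) (simp add: rowA)
    finally show ?thesis by (simp add: sum_distrib_left mult.assoc)
  qed
  have t3: "(\<Sum>i\<in>A. \<Sum>j\<in>A. \<Sum>k\<in>B. p i * X j k) = (\<Sum>i\<in>A. p i) * (\<Sum>i\<in>A. \<Sum>k\<in>B. X i k)"
    by (simp add: sum_distrib_left[symmetric] sum_distrib_right[symmetric])
  have t4: "(\<Sum>i\<in>A. \<Sum>j\<in>A. \<Sum>k\<in>B. p i * X i k) = H * (\<Sum>i\<in>A. p i * (\<Sum>k\<in>B. X i k))"
    by (simp add: cA sum_distrib_left)
  have t5: "(\<Sum>i\<in>A. \<Sum>j\<in>A. \<Sum>k\<in>B. d j k * X i i) = H * ((\<Sum>j\<in>A. q j) * (\<Sum>i\<in>A. X i i))"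
    by (simp add: rowB sum_distrib_left[symmetric] sum_distrib_right[symmetric] mult.assoc)
  have t6: "(\<Sum>i\<in>A. \<Sum>j\<in>A. \<Sum>k\<in>B. d j k * X i j) = H * (\<Sum>j\<in>A. q j * (\<Sum>i\<in>A. X j i))"
  proof -
    have "(\<Sum>i\<in>A. \<Sum>j\<in>A. \<Sum>k\<in>B. d j k * X i j) = (\<Sum>i\<in>A. \<Sum>j\<in>A. (H * q j) * X j i)"
      by (auto intro!: sum.cong simp: rowB X sum_distrib_right[symmetric])
    also have "\<dots> = (\<Sum>j\<in>A. \<Sum>i\<in>A. (H * q j) * X j i)" by (rule sum.swap)
    finally show ?thesis by (simp add: sum_distrib_left mult.assoc)
  qed
  have t7: "(\<Sum>i\<in>A. \<Sum>j\<in>A. \<Sum>k\<in>B. p i * X i i) = H * (H * (\<Sum>i\<in>A. p i * X i i))"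
    by (simp add: cA cB sum_distrib_left)
  have t8: "(\<Sum>i\<in>A. \<Sum>j\<in>A. \<Sum>k\<in>B. p i * X i j) = H * (\<Sum>i\<in>A. p i * (\<Sum>j\<in>A. X i j))"
    by (simp add: cB sum_distrib_left)
  have triangle: "(\<Sum>i\<in>A. \<Sum>j\<in>A. \<Sum>k\<in>B.
        (d j k + p i - m i j k) * (X i i + X j k - X i j - X i k)) =
      (\<Sum>i\<in>A. \<Sum>j\<in>A. \<Sum>k\<in>B. d j k * X j k) - (\<Sum>i\<in>A. \<Sum>j\<in>A. \<Sum>k\<in>B. d j k * X i k)
    + (\<Sum>i\<in>A. \<Sum>j\<in>A. \<Sum>k\<in>B. p i * X j k) - (\<Sum>i\<in>A. \<Sum>j\<in>A. \<Sum>k\<in>B. p i * X i k)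
    + (\<Sum>i\<in>A. \<Sum>j\<in>A. \<Sum>k\<in>B. d j k * X i i) - (\<Sum>i\<in>A. \<Sum>j\<in>A. \<Sum>k\<in>B. d j k * X i j)
    + (\<Sum>i\<in>A. \<Sum>j\<in>A. \<Sum>k\<in>B. p i * X i i) - (\<Sum>i\<in>A. \<Sum>j\<in>A. \<Sum>k\<in>B. p i * X i j)
    - (\<Sum>i\<in>A. \<Sum>j\<in>A. \<Sum>k\<in>B. m i j k * X j k) + (\<Sum>i\<in>A. \<Sum>j\<in>A. \<Sum>k\<in>B. m i j k * X i k)
    - (\<Sum>i\<in>A. \<Sum>j\<in>A. \<Sum>k\<in>B. m i j k * (X i i - X i j))"
    unfolding sum.distrib[symmetric] sum_subtractf[symmetric]
    by (intro sum.cong refl) (simp add: algebra_simps)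
  have pair: "(\<Sum>i\<in>A. \<Sum>j\<in>A. recovery_slack d A B e i j * (X i i - X i j)) =
      1 / H * (\<Sum>i\<in>A. \<Sum>j\<in>A. \<Sum>k\<in>B. m i j k * (X i i - X i j))
      - (\<Sum>i\<in>A. \<Sum>j\<in>A. d i j * X i i) + (\<Sum>i\<in>A. \<Sum>j\<in>A. d i j * X i j)
      - (\<Sum>i\<in>A. \<Sum>j\<in>A. e * X i i) + (\<Sum>i\<in>A. \<Sum>j\<in>A. e * X i j)"
    unfolding recovery_slack_def cB m_def[symmetric] sum_distrib_left
      sum.distrib[symmetric] sum_subtractf[symmetric]
    by (intro sum.cong refl)
      (simp add: algebra_simps sum_distrib_left sum_distrib_right sum_subtractf diff_divide_distrib)
  have u1: "(\<Sum>i\<in>A. \<Sum>j\<in>A. d i j * X i i) = H * (\<Sum>i\<in>A. p i * X i i)"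
    by (simp add: rowA sum_distrib_left sum_distrib_right[symmetric] mult.assoc)
  have u2: "(\<Sum>i\<in>A. \<Sum>j\<in>A. e * X i i) = H * (e * (\<Sum>i\<in>A. X i i))"
    by (simp add: cA sum_distrib_left)
  have u3: "(\<Sum>i\<in>A. \<Sum>j\<in>A. e * X i j) = e * (\<Sum>i\<in>A. \<Sum>j\<in>A. X i j)"
    by (simp add: sum_distrib_left)
  have v: "(\<Sum>i\<in>A. p i * ((\<Sum>j\<in>A. X i j) + (\<Sum>k\<in>B. X i k))) =
      (\<Sum>i\<in>A. p i * (\<Sum>j\<in>A. X i j)) + (\<Sum>i\<in>A. p i * (\<Sum>k\<in>B. X i k))"
    by (simp add: distrib_left sum.distrib)
  show ?thesis
    unfolding cluster_surplus_def cB p_def[symmetric] q_def[symmetric] m_def[symmetric]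
      H_def[symmetric] triangle pair m_cancel t1 t2 t3 t4 t5 t6 t7 t8 u1 u2 u3 v
    using H by (simp add: field_simps)
qed

text \<open>
  Adding the linear forms of both clusters, the row-sum constraint turns each sum of an average
  against a row of \<open>X\<close> into a sum of averages, and the trace constraint does the same for the
  diagonal. The averages between the clusters cancel because both clusters have the same total.
  Since \<open>2 * e\<close> is the sum of the two mean inner averages, the multiples of the mass of \<open>X\<close>
  between the clusters cancel against the explicit terms with \<open>e\<close>. Only the sum of all inner
  averages survives, and it equals \<open>2 * h * e\<close>.
\<close>

lemma objective_eq_surplus:
  fixes d X :: "nat \<Rightarrow> nat \<Rightarrow> real"
  assumes fin: "finite A" "finite B" and AB: "A \<inter> B = {}"
    and hA: "card A = h" and hB: "card B = h" and h: "h > 0"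
    and d: "\<And>i j. d i j = d j i"
    and X: "\<And>i j. i \<in> A \<union> B \<Longrightarrow> j \<in> A \<union> B \<Longrightarrow> X i j = X j i"
    and row: "\<And>i. i \<in> A \<union> B \<Longrightarrow> (\<Sum>j\<in>A \<union> B. X i j) = 1"
    and trace: "(\<Sum>i\<in>A \<union> B. X i i) = 2"
    and e: "e = 1 / 2 * (1 / real h * (\<Sum>i\<in>A. avg_in d A i) + 1 / real h * (\<Sum>i\<in>B. avg_in d B i))"
  shows "(\<Sum>i\<in>A \<union> B. \<Sum>j\<in>A \<union> B. d i j * X i j) =
           2 * real h * e + cluster_surplus d A B e X + cluster_surplus d B A e X"
proof -
  have split: "(\<Sum>i\<in>A \<union> B. f i) = (\<Sum>i\<in>A. f i) + (\<Sum>i\<in>B. f i)" for f :: "nat \<Rightarrow> real"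
    using fin AB by (rule sum.union_disjoint)
  have XB: "\<And>i j. i \<in> B \<union> A \<Longrightarrow> j \<in> B \<union> A \<Longrightarrow> X i j = X j i"
    using X by blast
  have rA: "(\<Sum>j\<in>A. X i j) + (\<Sum>j\<in>B. X i j) = 1" if "i \<in> A" for i
    using row[of i] that by (simp add: split)
  have rB: "(\<Sum>j\<in>B. X i j) + (\<Sum>j\<in>A. X i j) = 1" if "i \<in> B" for i
    using row[of i] that by (simp add: split)
  have pA: "(\<Sum>i\<in>A. f i * ((\<Sum>j\<in>A. X i j) + (\<Sum>j\<in>B. X i j))) = (\<Sum>i\<in>A. f i)" for f :: "nat \<Rightarrow> real"
    by (intro sum.cong refl) (simp add: rA)
  have pB: "(\<Sum>i\<in>B. f i * ((\<Sum>j\<in>B. X i j) + (\<Sum>j\<in>A. X i j))) = (\<Sum>i\<in>B. f i)" for f :: "nat \<Rightarrow> real"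
    by (intro sum.cong refl) (simp add: rB)
  have qA: "(\<Sum>i\<in>A. f i * (\<Sum>j\<in>A. X i j)) = (\<Sum>i\<in>A. f i) - (\<Sum>i\<in>A. f i * (\<Sum>j\<in>B. X i j))"
    for f :: "nat \<Rightarrow> real"
    unfolding pA[of f, symmetric] by (simp add: distrib_left sum.distrib)
  have qB: "(\<Sum>i\<in>B. f i * (\<Sum>j\<in>B. X i j)) = (\<Sum>i\<in>B. f i) - (\<Sum>i\<in>B. f i * (\<Sum>j\<in>A. X i j))"
    for f :: "nat \<Rightarrow> real"
    unfolding pB[of f, symmetric] by (simp add: distrib_left sum.distrib)
  define W where "W = (\<Sum>i\<in>A. \<Sum>k\<in>B. X i k)"
  have WB: "(\<Sum>i\<in>B. \<Sum>k\<in>A. X i k) = W"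
    unfolding W_def by (subst sum.swap) (auto intro!: sum.cong simp: X)
  have massA: "(\<Sum>i\<in>A. \<Sum>j\<in>A. X i j) = real h - W"
    using qA[of "\<lambda>_. 1"] hA by (simp add: W_def)
  have massB: "(\<Sum>i\<in>B. \<Sum>j\<in>B. X i j) = real h - W"
    using qB[of "\<lambda>_. 1"] hB WB by simp
  define Q where "Q = (\<Sum>i\<in>A. avg_in d B i)"
  \<comment> \<open>This needs equal cluster sizes: both totals are the sum of \<open>d\<close> over \<open>A \<times> B\<close>, divided by \<open>h\<close>.\<close>
  have QB: "(\<Sum>i\<in>B. avg_in d A i) = Q"
  proof -
    have "(\<Sum>i\<in>B. \<Sum>j\<in>A. d i j) = (\<Sum>i\<in>A. \<Sum>j\<in>B. d i j)"
      by (subst sum.swap) (simp add: d)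
    then show ?thesis
      unfolding Q_def avg_in_def hA hB sum_distrib_left[symmetric] by simp
  qed
  define tA where "tA = (\<Sum>i\<in>A. X i i)"
  have tB: "(\<Sum>i\<in>B. X i i) = 2 - tA"
    using trace by (simp add: split tA_def)
  define PA where "PA = (\<Sum>i\<in>A. avg_in d A i)"
  define PB where "PB = (\<Sum>i\<in>B. avg_in d B i)"
  have P: "PB = 2 * real h * e - PA"
    using h unfolding e PA_def PB_def by (simp add: field_simps)
  have objective: "(\<Sum>i\<in>A \<union> B. \<Sum>j\<in>A \<union> B. d i j * X i j) =
      (\<Sum>i\<in>A. \<Sum>j\<in>A. d i j * X i j) + (\<Sum>i\<in>A. \<Sum>k\<in>B. d i k * X i k)
      + ((\<Sum>i\<in>B. \<Sum>j\<in>B. d i j * X i j) + (\<Sum>i\<in>B. \<Sum>k\<in>A. d i k * X i k))"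
    by (simp add: split sum.distrib)
  show ?thesis
    unfolding objective
    apply (subst cluster_surplus_linear[where d = d, OF hA hB h d X], assumption, assumption)
    apply (subst cluster_surplus_linear[where d = d, OF hB hA h d XB], assumption, assumption)
    \<comment> \<open>Once row sums, trace, \<open>Q\<close> and \<open>PB\<close> are substituted, only field arithmetic is left.\<close>
    unfolding
      pA pB qA qB massA massB W_def[symmetric] WB Q_def[symmetric] QB tA_def[symmetric] tB
      PA_def[symmetric] PB_def[symmetric] P
    using h by (simp add: field_simps)
qed

section \<open>Sign of the weighted slacks\<close>

text \<open>
  Swapping \<open>i\<close> and \<open>j\<close> turns the second part of the surplus into half the weighted sum of
  \<open>X i i + X j j - 2 * X i j\<close>. This quantity is the sum of the slacks of the triangle inequalities
  at \<open>i\<close> and at \<open>j\<close> with a common third index, which can be any element of the other cluster.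
\<close>

lemma cluster_surplus_nonneg:
  fixes d X :: "nat \<Rightarrow> nat \<Rightarrow> real"
  assumes AB: "A \<inter> B = {}" and B: "B \<noteq> {}"
    and d: "\<And>i j. d i j = d j i"
    and X: "\<And>i j. i \<in> A \<union> B \<Longrightarrow> j \<in> A \<union> B \<Longrightarrow> X i j = X j i"
    and triangle: "\<And>i j k. i \<in> A \<union> B \<Longrightarrow> j \<in> A \<union> B \<Longrightarrow> k \<in> A \<union> B \<Longrightarrow>
      i \<noteq> j \<Longrightarrow> i \<noteq> k \<Longrightarrow> j \<noteq> k \<Longrightarrow> X i j + X i k \<le> X i i + X j k"
    and slack: "\<And>i j. i \<in> A \<Longrightarrow> j \<in> A \<Longrightarrow> recovery_slack d A B e i j \<ge> 0"
  shows "cluster_surplus d A B e X \<ge> 0"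
proof -
  have tri: "X i i + X j k - X i j - X i k \<ge> 0" if "i \<in> A" "j \<in> A" "k \<in> B" for i j k
  proof (cases "i = j")
    case False
    moreover have "i \<noteq> k" "j \<noteq> k" using that AB by auto
    ultimately show ?thesis using triangle[of i j k] that by simp
  qed simp
  have "(\<Sum>i\<in>A. \<Sum>j\<in>A. \<Sum>k\<in>B.
      (d j k + avg_in d A i - cross_min d A i j k) * (X i i + X j k - X i j - X i k)) \<ge> 0"
    by (intro sum_nonneg mult_nonneg_nonneg tri) (auto simp: cross_min_def)
  moreover have "(\<Sum>i\<in>A. \<Sum>j\<in>A. recovery_slack d A B e i j * (X i i - X i j)) \<ge> 0" (is "?G \<ge> 0")
  proof -
    obtain k where k: "k \<in> B" using B by blast
    have "?G = (\<Sum>i\<in>A. \<Sum>j\<in>A. recovery_slack d A B e i j * (X j j - X i j))"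
      by (subst sum.swap, intro sum.cong refl)
        (simp add: recovery_slack_commute[where d = d, OF d] X)
    then have "2 * ?G = ?G + (\<Sum>i\<in>A. \<Sum>j\<in>A. recovery_slack d A B e i j * (X j j - X i j))"
      by linarith
    also have "\<dots> = (\<Sum>i\<in>A. \<Sum>j\<in>A. recovery_slack d A B e i j * (X i i + X j j - 2 * X i j))"
      unfolding sum.distrib[symmetric] by (intro sum.cong refl) (simp add: algebra_simps)
    also have "\<dots> \<ge> 0"
    proof (intro sum_nonneg mult_nonneg_nonneg slack)
      fix i j assume ij: "i \<in> A" "j \<in> A"
      then have "X j i = X i j" by (metis X UnCI)
      then show "X i i + X j j - 2 * X i j \<ge> 0"
        using tri[OF ij k] tri[OF ij(2,1) k] by linarith
    qed
    finally show ?thesis by simp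
  qed
  ultimately show ?thesis by (simp add: cluster_surplus_def)
qed

text \<open>
  Complementary slackness: the inequalities entering the surplus of \<open>A\<close> hold with equality as soon
  as \<open>X\<close> is constant on \<open>A \<times> A\<close> and vanishes between \<open>A\<close> and \<open>B\<close>.
\<close>

lemma cluster_surplus_eq_0:
  assumes "\<And>i j. i \<in> A \<Longrightarrow> j \<in> A \<Longrightarrow> X i j = c"
    and "\<And>i k. i \<in> A \<Longrightarrow> k \<in> B \<Longrightarrow> X i k = 0"
  shows "cluster_surplus d A B e X = 0"
  by (simp add: cluster_surplus_def assms)

section \<open>The ratio-cut matrix of the planted clusters\<close>

lemma ratio_cut_matrix_eq:
  assumes "even n" "i \<in> {1..n}" "j \<in> {1..n}"
  shows "ratio_cut_matrix n i j = (if i \<le> n div 2 \<longleftrightarrow> j \<le> n div 2 then 2 / real n else 0)"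
proof (cases "i = j")
  case True
  then show ?thesis using ratio_cut_matrix_diag[OF assms(1,2)] by simp
next
  case False
  then show ?thesis using assms
    by (auto simp: ratio_cut_matrix_def ratio_cut_vector_def planted_cluster_def)
qed

lemma lp2_feasible_ratio_cut_matrix:
  assumes "even n" "n > 0"
  shows "lp2_feasible n (ratio_cut_matrix n)"
proof -
  note eq = ratio_cut_matrix_eq[OF assms(1)]
  have "(\<Sum>j\<in>{1..n}. ratio_cut_matrix n i j) = 1" if i: "i \<in> {1..n}" for i
  proof -
    have "(\<Sum>j\<in>{1..n}. ratio_cut_matrix n i j) =
        ratio_cut_matrix n i i + (\<Sum>j\<in>{1..n} - {i}. ratio_cut_matrix n i j)"
      by (rule sum.remove) (use i in auto)
    also have "(\<Sum>j\<in>{1..n} - {i}. ratio_cut_matrix n i j) = (\<Sum>j\<in>{1..n} - {i}. ratio_cut_vector n i j)"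
      by (intro sum.cong refl) (auto simp: ratio_cut_matrix_def)
    finally show ?thesis by (simp add: ratio_cut_matrix_def)
  qed
  then show ?thesis using assms(2) by (auto simp: lp2_feasible_def eq)
qed

theorem theorem1:
  fixes n :: nat and x :: "nat \<Rightarrow> real ^ 'm"
  assumes "n \<ge> 4" and "even n"
    and "\<And>l i j. l \<in> {1, 2} \<Longrightarrow> i \<in> planted_cluster n l \<Longrightarrow> j \<in> planted_cluster n l \<Longrightarrow>
           1 / real (card ({1..n} - planted_cluster n l)) *
             (\<Sum>k\<in>{1..n} - planted_cluster n l.
                min (sqdist x i k + avg_in (sqdist x) (planted_cluster n l) j)
                    (sqdist x j k + avg_in (sqdist x) (planted_cluster n l) i))
           - sqdist x i j \<ge> planted_eta (sqdist x) n"
  shows "lp2_optimal n (sqdist x) (ratio_cut_matrix n)"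
proof -
  define h where "h = n div 2"
  define A where "A = planted_cluster n 1"
  define B where "B = planted_cluster n 2"
  define d where "d = sqdist x"
  define e where "e = planted_eta d n"
  have n: "n = 2 * h" and h: "h > 0" using assms(1,2) by (auto simp: h_def)
  have A: "A = {1..h}" and B: "B = {h + 1..n}"
    by (auto simp: A_def B_def planted_cluster_def h_def)
  have U: "{1..n} = A \<union> B" and AB: "A \<inter> B = {}" and fin: "finite A" "finite B"
    and hA: "card A = h" and hB: "card B = h" and ne: "A \<noteq> {}" "B \<noteq> {}"
    using n h by (auto simp: A B)
  have BA: "B \<inter> A = {}" and compl: "{1..n} - A = B" "{1..n} - B = A" using U AB by auto
  have d: "d i j = d j i" for i j by (simp add: d_def sqdist_def norm_minus_commute)
  have e: "e = 1 / 2 * (1 / real h * (\<Sum>i\<in>A. avg_in d A i) + 1 / real h * (\<Sum>i\<in>B. avg_in d B i))"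
    using hA hB by (simp add: e_def planted_eta_def A_def B_def)
  have sA: "recovery_slack d A B e i j \<ge> 0" if "i \<in> A" "j \<in> A" for i j
    using assms(3)[of 1 i j] that
    unfolding A_def[symmetric] compl d_def[symmetric] e_def[symmetric] recovery_slack_def cross_min_def
    by simp
  have sB: "recovery_slack d B A e i j \<ge> 0" if "i \<in> B" "j \<in> B" for i j
    using assms(3)[of 2 i j] that
    unfolding B_def[symmetric] compl d_def[symmetric] e_def[symmetric] recovery_slack_def cross_min_def
    by simp
  have objective: "lp2_objective n d Y = 2 * real h * e + cluster_surplus d A B e Y + cluster_surplus d B A e Y"
    if "lp2_feasible n Y" for Y
    unfolding lp2_objective_def U
    by (rule objective_eq_surplus[OF fin AB hA hB h d _ _ _ e])
      (use that in \<open>auto simp: lp2_feasible_def U[symmetric]\<close>)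
  have lower: "2 * real h * e \<le> lp2_objective n d Y" if Y: "lp2_feasible n Y" for Y
  proof -
    have "cluster_surplus d A B e Y \<ge> 0"
      by (rule cluster_surplus_nonneg[OF AB ne(2) d _ _ sA])
        (use Y in \<open>auto simp: lp2_feasible_def U[symmetric]\<close>)
    moreover have "cluster_surplus d B A e Y \<ge> 0"
      by (rule cluster_surplus_nonneg[OF BA ne(1) d _ _ sB])
        (use Y in \<open>auto simp: lp2_feasible_def U[symmetric] Un_commute[of B A]\<close>)
    ultimately show ?thesis by (simp add: objective[OF Y])
  qed
  have feasible: "lp2_feasible n (ratio_cut_matrix n)"
    using assms(1,2) by (intro lp2_feasible_ratio_cut_matrix) auto
  have entry: "ratio_cut_matrix n i j = (if i \<le> h \<longleftrightarrow> j \<le> h then 2 / real n else 0)"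
    if "i \<in> A \<union> B" "j \<in> A \<union> B" for i j
    using ratio_cut_matrix_eq[OF assms(2), of i j] that unfolding U[symmetric] h_def by simp
  have "cluster_surplus d A B e (ratio_cut_matrix n) = 0"
    by (rule cluster_surplus_eq_0[where c = "2 / real n"]) (auto simp: entry, auto simp: A B)
  moreover have "cluster_surplus d B A e (ratio_cut_matrix n) = 0"
    by (rule cluster_surplus_eq_0[where c = "2 / real n"]) (auto simp: entry, auto simp: A B)
  ultimately have "lp2_objective n d (ratio_cut_matrix n) = 2 * real h * e"
    by (simp add: objective[OF feasible])
  then show ?thesis
    using feasible lower by (simp add: lp2_optimal_def d_def)
qed

end
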